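(* Let $M$ and $N$ be nonempty closed bounded convex subsets of a Hilbert space $X$. Let $F:M\cup N\to M\cup N$ satisfy (1) $F(M)\subseteq N$ and $F(N)\subseteq M$; and (2) $\|Fw-Fz\|\le\|w-z\|$ for all $w\in M$, $z\in N$. Let $\epsilon\in(0,1/2)$ and $\eta_n,\delta_n\in(\epsilon,1-\epsilon)$ for $n=0,1,2,\dots$. If $F$ maps $M$ into a compact subset of $N$, then for any $w_0\in M_0$ the sequence defined by $$w_{n+1}=(1-\eta_n)w_n+\eta_nP_M\Big(F\big((1-\delta_n)w_n+\delta_nP_MFw_n\big)\Big),\qquad n=0,1,2,\dots,$$ converges (in norm) to some $w\in M_0$ such that $\|w-Fw\|=d(M,N)$.
   Context: For subsets $M,N$ of a Hilbert space $X$: $d(M,N)=\inf\{\|w-z\|: w\in M, z\in N\}$ and $M_0=\{w\in M:\|w-z'\|=d(M,N)\text{ for some } z'\in N\}$. $P_M:X\to M$ denotes the metric (nearest point) projection onto the closed convex set $M$. The map $F$ is not assumed to be continuous. *)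

theory Defs
  imports "HOL-Analysis.Analysis"
begin

text \<open>
  A Hilbert space is a type of class \<open>{real_inner, complete_space}\<close>, and the distance
  \<open>d(M,N)\<close> is \<^const>\<open>setdist\<close>. A complex Hilbert space is covered by restricting scalars,
  since only the norm and convexity are involved.
\<close>

text \<open>
  The library's \<^const>\<open>closest_point\<close> has sort \<open>{real_inner, heine_borel}\<close>, which forces
  finite dimension; this is the same definition without that restriction. For a nonempty closed
  convex set in a Hilbert space the selected point exists and is unique.
\<close>

definition metric_proj :: "'a::metric_space set \<Rightarrow> 'a \<Rightarrow> 'a" where
  "metric_proj M x = (SOME w. w \<in> M \<and> (\<forall>y\<in>M. dist x w \<le> dist x y))"

lemma metric_proj_eq_closest_point: "metric_proj M x = closest_point M x"
  by (simp add: metric_proj_def closest_point_def)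

text \<open>The set \<open>M\<^sub>0\<close> relative to \<open>N\<close>.\<close>

definition proximal_part :: "'a::real_normed_vector set \<Rightarrow> 'a set \<Rightarrow> 'a set" where
  "proximal_part M N = {w \<in> M. \<exists>z\<in>N. norm (w - z) = setdist M N}"

end

theory Submission
  imports Defs
begin

text \<open>
  Two convex sets attain their distance with only one displacement vector \<open>h\<close>. The proximal
  part of \<open>M\<close> is therefore \<open>M \<inter> (N - h)\<close>, a closed convex set, and on its translate by \<open>h\<close> the
  metric projection onto \<open>M\<close> is subtraction of \<open>h\<close> (\<open>proximal_part_eq\<close>,
  \<open>metric_proj_displaced\<close>). Since \<open>F\<close> swaps the two sets and does not increase distances
  between them, it sends a pair at minimal distance to another such pair; hence
  \<open>F (u + h) = F u - h\<close> for \<open>u\<close> in the proximal part. So \<open>T = P\<^sub>M \<circ> F\<close> acts there as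
  \<open>u \<mapsto> F u - h\<close>, and comparing the distances of the two crossed pairs shows that \<open>T\<close> is
  nonexpansive, although \<open>F\<close> is only controlled between points of different sets
  (\<open>nonexpansive_from_crossed_bounds\<close>). The fixed points of \<open>T\<close> are exactly the \<open>u\<close> with
  \<open>F u = u + h\<close>.

  The given sequence is now the Ishikawa iteration of a nonexpansive self-map \<open>T\<close> with relatively
  compact range on a complete convex set. Approximating \<open>T\<close> by contractions yields a fixed point.
  Each iteration step lowers the squared distance to every fixed point by at least a constant
  multiple of \<open>(norm (w n - T (w n)))\<^sup>2\<close>, so this residual tends to \<open>0\<close>. By compactness a
  subsequence converges to a fixed point, and monotonicity of the distance to that point carries
  the convergence over to the whole sequence (\<open>ishikawa_iteration_converges\<close>).
\<close>

section \<open>Displacements of minimal norm between convex sets\<close>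

lemma power2_norm_convex_comb:
  fixes a b :: "'a::real_inner"
  shows "(norm ((1 - t) *\<^sub>R a + t *\<^sub>R b))\<^sup>2
    = (1 - t) * (norm a)\<^sup>2 + t * (norm b)\<^sup>2 - t * (1 - t) * (norm (a - b))\<^sup>2"
  unfolding power2_norm_eq_inner by (simp add: inner_simps inner_commute algebra_simps)

text \<open>
  The midpoint of two displacements from \<open>M\<close> to \<open>N\<close> is again such a displacement, so by strict
  convexity of the norm two displacements of minimal norm cannot differ.
\<close>

lemma minimal_displacement_unique:
  fixes M N :: "'a::real_inner set"
  assumes "convex M" "convex N"
    and u: "u \<in> M" "u + h \<in> N" "norm h = setdist M N"
    and v: "v \<in> M" "v + k \<in> N" "norm k = setdist M N"
  shows "k = h"
proof -
  let ?m = "(1 - 1/2) *\<^sub>R u + (1/2) *\<^sub>R v"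
  let ?n = "(1 - 1/2) *\<^sub>R (u + h) + (1/2) *\<^sub>R (v + k)"
  have "?m \<in> M" "?n \<in> N"
    by (rule convexD_alt; use assms in simp)+
  then have "setdist M N \<le> dist ?n ?m"
    by (metis setdist_le_dist dist_commute)
  also have "dist ?n ?m = norm ((1 - 1/2) *\<^sub>R h + (1/2) *\<^sub>R k)"
    by (simp add: dist_norm algebra_simps)
  finally have "(setdist M N)\<^sup>2 \<le> (norm ((1 - 1/2) *\<^sub>R h + (1/2) *\<^sub>R k))\<^sup>2"
    by (simp add: power_mono setdist_pos_le)
  then have "(norm (h - k))\<^sup>2 \<le> 0"
    unfolding power2_norm_convex_comb using u(3) v(3) by simp
  then show ?thesis by simp
qed

lemma proximal_part_eq:
  fixes M N :: "'a::real_inner set"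
  assumes "convex M" "convex N" "u0 \<in> M" "u0 + h \<in> N" "norm h = setdist M N"
  shows "proximal_part M N = {u \<in> M. u + h \<in> N}"
proof -
  have "u + h \<in> N" if "u \<in> M" "z \<in> N" "norm (u - z) = setdist M N" for u z
    using minimal_displacement_unique[OF assms, of u "z - u"] that by (auto simp: norm_minus_commute)
  moreover have "norm (u - (u + h)) = setdist M N" for u
    using assms(5) by simp
  ultimately show ?thesis
    unfolding proximal_part_def by blast
qed

lemma metric_proj_displaced:
  fixes M N :: "'a::real_inner set"
  assumes "convex M" "convex N" "u \<in> M" "u + h \<in> N" "norm h = setdist M N"
  shows "metric_proj M (u + h) = u"
proof -
  let ?p = "metric_proj M (u + h)"
  have "dist (u + h) u \<le> dist (u + h) y" if "y \<in> M" for y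
    using setdist_le_dist[OF that assms(4)] assms(5) by (simp add: dist_norm norm_minus_commute)
  then have p: "?p \<in> M" "\<forall>y\<in>M. dist (u + h) ?p \<le> dist (u + h) y"
    unfolding metric_proj_def
    using someI[of "\<lambda>w. w \<in> M \<and> (\<forall>y\<in>M. dist (u + h) w \<le> dist (u + h) y)" u] assms(3)
    by blast+
  have "norm (u + h - ?p) \<le> setdist M N"
    using p(2) assms(3,5) by (auto simp: dist_norm)
  moreover have "setdist M N \<le> norm (u + h - ?p)"
    using setdist_le_dist[OF p(1) assms(4)] by (simp add: dist_norm norm_minus_commute)
  ultimately have "u + h - ?p = h"
    using minimal_displacement_unique[OF assms, of ?p "u + h - ?p"] p(1) assms(4) by simp
  then show ?thesis by (simp add: algebra_simps)
qed

text \<open>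
  For \<open>b = u - v\<close> and \<open>a = T u - T v\<close> the hypotheses are the bounds on the two crossed pairs
  \<open>u, v + h\<close> and \<open>v, u + h\<close>. The inner products with \<open>h\<close> cancel when the squared bounds are added.
\<close>

lemma nonexpansive_from_crossed_bounds:
  fixes a b h :: "'a::real_inner"
  assumes "norm (a + h) \<le> norm (b - h)" "norm (a - h) \<le> norm (b + h)"
  shows "norm a \<le> norm b"
proof -
  have "(norm (a + h))\<^sup>2 + (norm (a - h))\<^sup>2 \<le> (norm (b - h))\<^sup>2 + (norm (b + h))\<^sup>2"
    using assms by (intro add_mono power_mono) auto
  then have "(norm a)\<^sup>2 \<le> (norm b)\<^sup>2"
    by (simp add: power2_norm_eq_inner inner_simps inner_commute)
  then show ?thesis by (rule power2_le_imp_le) simp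
qed

section \<open>Nonexpansive maps with relatively compact range\<close>

text \<open>
  Compactness makes the images converge along a subsequence; the vanishing residual forces the
  points themselves to the same limit.
\<close>

lemma approximate_fixed_points_cluster:
  fixes T :: "'a::real_normed_vector \<Rightarrow> 'a"
  assumes "closed C" "\<And>n. x n \<in> C" "compact K" "T ` C \<subseteq> K"
    and nonexp: "\<And>u v. u \<in> C \<Longrightarrow> v \<in> C \<Longrightarrow> norm (T u - T v) \<le> norm (u - v)"
    and residual: "(\<lambda>n. x n - T (x n)) \<longlonglongrightarrow> 0"
  obtains q r where "q \<in> C" "T q = q" "strict_mono (r :: nat \<Rightarrow> nat)" "(x \<circ> r) \<longlonglongrightarrow> q"
proof -
  have "\<forall>n. T (x n) \<in> K"
    using assms(2,4) by auto
  then obtain q r where r: "strict_mono r" "(\<lambda>n. T (x (r n))) \<longlonglongrightarrow> q"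
    using assms(3)[unfolded compact_def, rule_format, of "\<lambda>n. T (x n)"] by (auto simp: o_def)
  have "(\<lambda>n. x (r n) - T (x (r n))) \<longlonglongrightarrow> 0"
    using LIMSEQ_subseq_LIMSEQ[OF residual r(1)] by (simp add: o_def)
  from tendsto_add[OF this r(2)] have xq: "(\<lambda>n. x (r n)) \<longlonglongrightarrow> q"
    by simp
  have "q \<in> C"
    using closed_sequentially[OF assms(1) _ xq] assms(2) by simp
  have "(\<lambda>n. norm (x (r n) - q)) \<longlonglongrightarrow> 0"
    using xq by (simp add: LIM_zero tendsto_norm_zero)
  moreover have "\<forall>n. norm (T (x (r n)) - T q) \<le> norm (x (r n) - q)"
    using nonexp assms(2) \<open>q \<in> C\<close> by simp
  ultimately have "(\<lambda>n. T (x (r n)) - T q) \<longlonglongrightarrow> 0"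
    by (intro Lim_null_comparison[of "\<lambda>n. T (x (r n)) - T q"]) auto
  then have "(\<lambda>n. T (x (r n))) \<longlonglongrightarrow> T q"
    by (rule LIM_zero_cancel)
  then have "T q = q"
    using r(2) LIMSEQ_unique by blast
  then show thesis
    using that \<open>q \<in> C\<close> r(1) xq by (simp add: o_def)
qed

text \<open>
  The maps \<open>u \<mapsto> s c + (1 - s) T u\<close> with \<open>0 < s\<close> are contractions, and as \<open>s\<close> tends to \<open>0\<close> their
  fixed points become approximate fixed points of \<open>T\<close>, because the range of \<open>T\<close> is bounded.
\<close>

lemma nonexpansive_compact_range_has_fixed_point:
  fixes T :: "'a::real_normed_vector \<Rightarrow> 'a"
  assumes "complete C" "convex C" "c \<in> C" "compact K" "T ` C \<subseteq> K" "T ` C \<subseteq> C"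
    and nonexp: "\<And>u v. u \<in> C \<Longrightarrow> v \<in> C \<Longrightarrow> norm (T u - T v) \<le> norm (u - v)"
  obtains p where "p \<in> C" "T p = p"
proof -
  define s :: "nat \<Rightarrow> real" where "s n = inverse (real (Suc n))" for n
  have s: "0 < s n" "s n \<le> 1" for n
    by (auto simp: s_def inverse_le_1_iff)
  have "\<exists>x\<in>C. s n *\<^sub>R c + (1 - s n) *\<^sub>R T x = x" for n
  proof -
    have "\<exists>!x\<in>C. s n *\<^sub>R c + (1 - s n) *\<^sub>R T x = x"
    proof (rule Banach_fix[OF assms(1), where c = "1 - s n"])
      show "(\<lambda>x. s n *\<^sub>R c + (1 - s n) *\<^sub>R T x) ` C \<subseteq> C"
        using assms(3,6) s[of n] by (auto intro!: convexD[OF assms(2)])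
      show "dist (s n *\<^sub>R c + (1 - s n) *\<^sub>R T x) (s n *\<^sub>R c + (1 - s n) *\<^sub>R T y) \<le> (1 - s n) * dist x y"
        if "x \<in> C" "y \<in> C" for x y
        using nonexp[OF that] s[of n]
        by (simp add: dist_norm mult_left_mono flip: scaleR_diff_right)
    qed (use assms(3) s[of n] in auto)
    then show ?thesis by blast
  qed
  then have "\<forall>n. \<exists>x. x \<in> C \<and> s n *\<^sub>R c + (1 - s n) *\<^sub>R T x = x"
    by blast
  from choice[OF this]
  obtain x where x: "\<And>n. x n \<in> C" "\<And>n. s n *\<^sub>R c + (1 - s n) *\<^sub>R T (x n) = x n"
    by blast
  obtain B where B: "\<And>y. y \<in> K \<Longrightarrow> norm y \<le> B"
    using compact_imp_bounded[OF assms(4)] unfolding bounded_iff by blast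
  have "norm (x n - T (x n)) \<le> s n * (norm c + B)" for n
  proof -
    have "x n - T (x n) = s n *\<^sub>R (c - T (x n))"
      by (subst x(2)[of n, symmetric]) (simp add: algebra_simps)
    moreover have "norm (c - T (x n)) \<le> norm c + B"
      using norm_triangle_ineq4[of c "T (x n)"] B[of "T (x n)"] assms(5) x(1)[of n] by fastforce
    ultimately show ?thesis
      using s(1)[of n] by (simp add: mult_left_mono)
  qed
  moreover have "(\<lambda>n. s n * (norm c + B)) \<longlonglongrightarrow> 0"
    unfolding s_def by (rule tendsto_mult_left_zero[OF LIMSEQ_inverse_real_of_nat])
  ultimately have residual: "(\<lambda>n. x n - T (x n)) \<longlonglongrightarrow> 0"
    by (intro Lim_null_comparison[of "\<lambda>n. x n - T (x n)"]) auto
  obtain q r where q: "q \<in> C" "T q = q" "strict_mono (r :: nat \<Rightarrow> nat)" "(x \<circ> r) \<longlonglongrightarrow> q"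
    by (rule approximate_fixed_points_cluster[of C x K T, OF complete_imp_closed[OF assms(1)] x(1)
        assms(4,5) nonexp residual])
  show thesis
    by (rule that[OF q(1,2)])
qed

section \<open>The Ishikawa iteration\<close>

text \<open>
  The gain over mere monotonicity is the last term of the identity for the squared norm of a
  convex combination, applied to the inner step.
\<close>

lemma ishikawa_step_descent:
  fixes T :: "'a::real_inner \<Rightarrow> 'a"
  assumes "convex C" "T ` C \<subseteq> C" "x \<in> C" "p \<in> C" "T p = p"
    and nonexp: "\<And>u v. u \<in> C \<Longrightarrow> v \<in> C \<Longrightarrow> norm (T u - T v) \<le> norm (u - v)"
    and "0 \<le> s" "s \<le> 1" "0 \<le> t" "t \<le> 1"
  shows "(norm ((1 - s) *\<^sub>R x + s *\<^sub>R T ((1 - t) *\<^sub>R x + t *\<^sub>R T x) - p))\<^sup>2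
    \<le> (norm (x - p))\<^sup>2 - s * t * (1 - t) * (norm (x - T x))\<^sup>2"
proof -
  define y where "y = (1 - t) *\<^sub>R x + t *\<^sub>R T x"
  have "y \<in> C"
    unfolding y_def using assms by (intro convexD_alt) auto
  have "(norm (y - p))\<^sup>2 = (norm ((1 - t) *\<^sub>R (x - p) + t *\<^sub>R (T x - p)))\<^sup>2"
    by (simp add: y_def algebra_simps)
  also have "\<dots> = (1 - t) * (norm (x - p))\<^sup>2 + t * (norm (T x - p))\<^sup>2
      - t * (1 - t) * (norm (x - T x))\<^sup>2"
    unfolding power2_norm_convex_comb by simp
  also have "\<dots> \<le> (1 - t) * (norm (x - p))\<^sup>2 + t * (norm (x - p))\<^sup>2
      - t * (1 - t) * (norm (x - T x))\<^sup>2"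
    using nonexp[of x p] assms by (intro diff_right_mono add_left_mono mult_left_mono power_mono) auto
  finally have y: "(norm (y - p))\<^sup>2 \<le> (norm (x - p))\<^sup>2 - t * (1 - t) * (norm (x - T x))\<^sup>2"
    by (simp add: algebra_simps)
  have "(norm (T y - p))\<^sup>2 \<le> (norm (y - p))\<^sup>2"
    using nonexp[OF \<open>y \<in> C\<close> \<open>p \<in> C\<close>] assms(5) by (intro power_mono) auto
  with y have Ty: "(norm (T y - p))\<^sup>2 \<le> (norm (x - p))\<^sup>2 - t * (1 - t) * (norm (x - T x))\<^sup>2"
    by linarith
  have "(norm ((1 - s) *\<^sub>R x + s *\<^sub>R T y - p))\<^sup>2 = (norm ((1 - s) *\<^sub>R (x - p) + s *\<^sub>R (T y - p)))\<^sup>2"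
    by (simp add: algebra_simps)
  also have "\<dots> \<le> (1 - s) * (norm (x - p))\<^sup>2 + s * (norm (T y - p))\<^sup>2"
    unfolding power2_norm_convex_comb using assms(7,8) by simp
  also have "\<dots> \<le> (1 - s) * (norm (x - p))\<^sup>2
      + s * ((norm (x - p))\<^sup>2 - t * (1 - t) * (norm (x - T x))\<^sup>2)"
    using Ty assms(7) by (intro add_left_mono mult_left_mono)
  finally show ?thesis
    unfolding y_def[symmetric] by (simp add: algebra_simps)
qed

lemma ishikawa_iteration_converges:
  fixes T :: "'a::real_inner \<Rightarrow> 'a"
  assumes "complete C" "convex C" "compact K" "T ` C \<subseteq> K" "T ` C \<subseteq> C"
    and nonexp: "\<And>u v. u \<in> C \<Longrightarrow> v \<in> C \<Longrightarrow> norm (T u - T v) \<le> norm (u - v)"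
    and "0 < \<epsilon>" and s: "\<And>n. \<epsilon> \<le> s n \<and> s n \<le> 1 - \<epsilon>" and t: "\<And>n. \<epsilon> \<le> t n \<and> t n \<le> 1 - \<epsilon>"
    and x: "\<And>n. x n \<in> C"
      "\<And>n. x (Suc n) = (1 - s n) *\<^sub>R x n + s n *\<^sub>R T ((1 - t n) *\<^sub>R x n + t n *\<^sub>R T (x n))"
  obtains q where "q \<in> C" "T q = q" "x \<longlonglongrightarrow> q"
proof -
  \<comment> \<open>Each of the three factors \<open>s n\<close>, \<open>t n\<close>, \<open>1 - t n\<close> of the descent is at least \<open>\<epsilon>\<close>.\<close>
  have descent: "(norm (x (Suc n) - p))\<^sup>2
      \<le> (norm (x n - p))\<^sup>2 - \<epsilon>^3 * (norm (x n - T (x n)))\<^sup>2"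
    if p: "p \<in> C" "T p = p" for p n
  proof -
    have "\<epsilon> * \<epsilon> * \<epsilon> \<le> s n * t n * (1 - t n)"
      using s[of n] t[of n] \<open>0 < \<epsilon>\<close> by (intro mult_mono) auto
    then have "\<epsilon>^3 * (norm (x n - T (x n)))\<^sup>2 \<le> s n * t n * (1 - t n) * (norm (x n - T (x n)))\<^sup>2"
      by (intro mult_right_mono) (auto simp: power3_eq_cube)
    moreover have "(norm (x (Suc n) - p))\<^sup>2
        \<le> (norm (x n - p))\<^sup>2 - s n * t n * (1 - t n) * (norm (x n - T (x n)))\<^sup>2"
      unfolding x(2)[of n]
      using s[of n] t[of n] \<open>0 < \<epsilon>\<close>
      by (intro ishikawa_step_descent[OF assms(2,5) x(1) p nonexp]) auto
    ultimately show ?thesis by linarith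
  qed
  have decreasing: "decseq (\<lambda>n. (norm (x n - p))\<^sup>2)" if p: "p \<in> C" "T p = p" for p
  proof (rule decseq_SucI)
    fix n
    have "0 \<le> \<epsilon>^3 * (norm (x n - T (x n)))\<^sup>2"
      using \<open>0 < \<epsilon>\<close> by simp
    with descent[OF p, of n] show "(norm (x (Suc n) - p))\<^sup>2 \<le> (norm (x n - p))\<^sup>2"
      by linarith
  qed
  obtain p where p: "p \<in> C" "T p = p"
    using nonexpansive_compact_range_has_fixed_point[OF assms(1,2) x(1)[of 0] assms(3,4,5)] nonexp
    by blast
  obtain L where L: "(\<lambda>n. (norm (x n - p))\<^sup>2) \<longlonglongrightarrow> L"
    using decseq_convergent[OF decreasing[OF p], of 0] by auto
  have "(\<lambda>n. ((norm (x n - p))\<^sup>2 - (norm (x (Suc n) - p))\<^sup>2) / \<epsilon>^3) \<longlonglongrightarrow> (L - L) / \<epsilon>^3"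
    using \<open>0 < \<epsilon>\<close> by (intro tendsto_intros L LIMSEQ_Suc[OF L]) auto
  moreover have "(norm (x n - T (x n)))\<^sup>2
      \<le> ((norm (x n - p))\<^sup>2 - (norm (x (Suc n) - p))\<^sup>2) / \<epsilon>^3" for n
    using descent[OF p, of n] \<open>0 < \<epsilon>\<close> by (simp add: field_simps)
  ultimately have "(\<lambda>n. (norm (x n - T (x n)))\<^sup>2) \<longlonglongrightarrow> 0"
    by (intro Lim_null_comparison[of "\<lambda>n. (norm (x n - T (x n)))\<^sup>2"]) auto
  then have "(\<lambda>n. norm (x n - T (x n))) \<longlonglongrightarrow> 0"
    by (simp add: tendsto_null_power)
  then have residual: "(\<lambda>n. x n - T (x n)) \<longlonglongrightarrow> 0"
    by (simp add: tendsto_norm_zero_iff)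
  obtain q r where q: "q \<in> C" "T q = q" "strict_mono (r :: nat \<Rightarrow> nat)" "(x \<circ> r) \<longlonglongrightarrow> q"
    by (rule approximate_fixed_points_cluster[of C x K T, OF complete_imp_closed[OF assms(1)] x(1)
        assms(3,4) nonexp residual])
  obtain L' where L': "(\<lambda>n. (norm (x n - q))\<^sup>2) \<longlonglongrightarrow> L'"
    using decseq_convergent[OF decreasing[OF q(1,2)], of 0] by auto
  have "(\<lambda>n. (norm (x (r n) - q))\<^sup>2) \<longlonglongrightarrow> (norm (q - q))\<^sup>2"
    using q(4) by (intro tendsto_intros) (simp add: o_def)
  moreover have "(\<lambda>n. (norm (x (r n) - q))\<^sup>2) \<longlonglongrightarrow> L'"
    using LIMSEQ_subseq_LIMSEQ[OF L' q(3)] by (simp add: o_def)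
  ultimately have "(norm (q - q))\<^sup>2 = L'"
    by (rule LIMSEQ_unique)
  with L' have "(\<lambda>n. norm (x n - q)) \<longlonglongrightarrow> 0"
    by (simp add: tendsto_null_power)
  then have "x \<longlonglongrightarrow> q"
    by (simp add: tendsto_norm_zero_iff LIM_zero_iff)
  then show thesis
    by (rule that[OF q(1,2)])
qed

section \<open>Convergence to a best proximity point\<close>

theorem corollary2p3:
  fixes M N :: "'a::{real_inner, complete_space} set"
    and F :: "'a \<Rightarrow> 'a"
    and \<epsilon> :: real
    and \<eta> \<delta> :: "nat \<Rightarrow> real"
    and w :: "nat \<Rightarrow> 'a"
  assumes "M \<noteq> {}" "closed M" "bounded M" "convex M"
    and "N \<noteq> {}" "closed N" "bounded N" "convex N"
    and "F ` (M \<union> N) \<subseteq> M \<union> N"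
    and "F ` M \<subseteq> N" "F ` N \<subseteq> M"
    and "\<And>u z. u \<in> M \<Longrightarrow> z \<in> N \<Longrightarrow> norm (F u - F z) \<le> norm (u - z)"
    and "\<epsilon> \<in> {0<..<1/2}"
    and "\<And>n. \<eta> n \<in> {\<epsilon><..<1 - \<epsilon>}"
    and "\<And>n. \<delta> n \<in> {\<epsilon><..<1 - \<epsilon>}"
    and "\<exists>K. compact K \<and> K \<subseteq> N \<and> F ` M \<subseteq> K"
    and "w 0 \<in> proximal_part M N"
    and "\<And>n. w (Suc n) = (1 - \<eta> n) *\<^sub>R w n
           + \<eta> n *\<^sub>R metric_proj M (F ((1 - \<delta> n) *\<^sub>R w n + \<delta> n *\<^sub>R metric_proj M (F (w n))))"
  shows "\<exists>l \<in> proximal_part M N. w \<longlonglongrightarrow> l \<and> norm (l - F l) = setdist M N"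
proof -
  obtain z where "w 0 \<in> M" "z \<in> N" "norm (w 0 - z) = setdist M N"
    using assms(17) unfolding proximal_part_def by blast
  then obtain h where h: "w 0 + h \<in> N" "norm h = setdist M N"
    by (metis add_diff_cancel_left' diff_add_cancel add.commute norm_minus_commute)
  define C where "C = proximal_part M N"
  have C_eq: "C = {u \<in> M. u + h \<in> N}"
    unfolding C_def using assms(4,8) \<open>w 0 \<in> M\<close> h by (intro proximal_part_eq)
  have C_Int: "C = M \<inter> (\<lambda>u. u - h) ` N"
    unfolding C_eq by (auto simp: image_iff algebra_simps intro!: bexI)
  have "convex C"
    unfolding C_Int using assms(4,8)
    by (intro convex_Int convex_translation_subtract)
  have "complete C"
    unfolding C_Int using assms(2,6)
    by (simp add: complete_eq_closed closed_Int closed_translation_subtract)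
  define T where "T u = F u - h" for u
  \<comment> \<open>The pair \<open>F u, F (u + h)\<close> is at least as close as \<open>u, u + h\<close>, hence again at minimal distance.\<close>
  have F_displaced: "F (u + h) = T u" if "u \<in> C" for u
  proof -
    have u: "u \<in> M" "u + h \<in> N" "F u \<in> N" "F (u + h) \<in> M"
      using that assms(10,11) unfolding C_eq by auto
    have "norm (F u - F (u + h)) \<le> setdist M N"
      using assms(12)[OF u(1,2)] h(2) by simp
    moreover have "setdist M N \<le> norm (F u - F (u + h))"
      using setdist_le_dist[OF u(4,3)] by (simp add: dist_norm norm_minus_commute)
    ultimately have "F u - F (u + h) = h"
      using minimal_displacement_unique[OF assms(4,8) \<open>w 0 \<in> M\<close> h, of "F (u + h)" "F u - F (u + h)"] u
      by simp
    then show ?thesis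
      by (simp add: T_def algebra_simps)
  qed
  have T_in_C: "T u \<in> C" if "u \<in> C" for u
    using that F_displaced[OF that] assms(10,11) unfolding C_eq T_def by auto
  have proj_F: "metric_proj M (F u) = T u" if "u \<in> C" for u
    using metric_proj_displaced[OF assms(4,8) _ _ h(2), of "T u"] T_in_C[OF that]
    unfolding C_eq T_def by simp
  have nonexp: "norm (T u - T v) \<le> norm (u - v)" if "u \<in> C" "v \<in> C" for u v
  proof (rule nonexpansive_from_crossed_bounds)
    have "norm (F u - F (v + h)) \<le> norm (u - (v + h))"
      using assms(12)[of u "v + h"] that unfolding C_eq by simp
    moreover have "F u - F (v + h) = T u - T v + h" "u - (v + h) = u - v - h"
      using F_displaced[OF that(2)] by (simp_all add: T_def)
    ultimately show "norm (T u - T v + h) \<le> norm (u - v - h)"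
      by (simp only:)
    have "norm (F v - F (u + h)) \<le> norm (v - (u + h))"
      using assms(12)[of v "u + h"] that unfolding C_eq by simp
    moreover have "F v - F (u + h) = - (T u - T v - h)" "v - (u + h) = - (u - v + h)"
      using F_displaced[OF that(1)] by (simp_all add: T_def)
    ultimately show "norm (T u - T v - h) \<le> norm (u - v + h)"
      by (simp only: norm_minus_cancel)
  qed
  obtain K where K: "compact K" "F ` M \<subseteq> K"
    using assms(16) by blast
  have K': "compact ((\<lambda>y. y - h) ` K)"
    using K(1) by (intro compact_translation_subtract)
  have T_in_K': "T ` C \<subseteq> (\<lambda>y. y - h) ` K"
    using K(2) unfolding T_def C_eq by auto
  have T_self: "T ` C \<subseteq> C"
    using T_in_C by blast
  have "0 < \<epsilon>"
    using assms(13) by simp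
  have \<eta>: "\<epsilon> \<le> \<eta> n \<and> \<eta> n \<le> 1 - \<epsilon>" and \<delta>: "\<epsilon> \<le> \<delta> n \<and> \<delta> n \<le> 1 - \<epsilon>" for n
    using assms(14)[of n] assms(15)[of n] by simp_all
  have inner: "(1 - \<delta> n) *\<^sub>R u + \<delta> n *\<^sub>R T u \<in> C" if "u \<in> C" for u n
    using that T_in_C[OF that] \<delta>[of n] \<open>0 < \<epsilon>\<close> \<open>convex C\<close> by (intro convexD_alt) auto
  have step: "w (Suc n) = (1 - \<eta> n) *\<^sub>R w n + \<eta> n *\<^sub>R T ((1 - \<delta> n) *\<^sub>R w n + \<delta> n *\<^sub>R T (w n))"
    if "w n \<in> C" for n
    unfolding assms(18)[of n] proj_F[OF that] proj_F[OF inner[OF that]] ..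
  have w_in_C: "w n \<in> C" for n
  proof (induction n)
    case 0
    show ?case
      using assms(17) unfolding C_def .
  next
    case (Suc n)
    show ?case
      unfolding step[OF Suc]
      using Suc T_in_C[OF inner[OF Suc]] \<eta>[of n] \<open>0 < \<epsilon>\<close> \<open>convex C\<close>
      by (intro convexD_alt) auto
  qed
  obtain q where q: "q \<in> C" "T q = q" "w \<longlonglongrightarrow> q"
    by (rule ishikawa_iteration_converges[of C _ T \<epsilon> \<eta> \<delta> w, OF \<open>complete C\<close> \<open>convex C\<close> K'
        T_in_K' T_self nonexp \<open>0 < \<epsilon>\<close> \<eta> \<delta> w_in_C step[OF w_in_C]])
  have "q - F q = - h"
    using q(2) by (simp add: T_def algebra_simps)
  then have "norm (q - F q) = setdist M N"
    using h(2) by simp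
  then show ?thesis
    using q unfolding C_def by blast
qed

end
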